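(* Let $W_{(\alpha(\omega),\beta(\omega))}$ be a $(p,q)$-embedding of $W_\omega$, where $W_\omega$ is a subnormal unilateral weighted shift with finitely atomic Berger measure $\sigma=\sum_{i=0}^{\ell-1}\rho_i\delta_{r_i}$, where $\sum_{i=0}^{\ell-1}\rho_i=1$, $\rho_i>0$, and $0\le r_0<r_1<\cdots<r_{\ell-1}$. Then the Berger measure $\mu$ of $W_{(\alpha(\omega),\beta(\omega))}$ is $$\mu=\sum_{i=0}^{\ell-1}\rho_i\,\delta_{(p(r_i),q(r_i))}.$$
   Context: $\mathbb{Z}_+=\{0,1,2,\dots\}$, $\mathbb{R}_+=[0,\infty)$, and $\delta_x$ is the point mass at $x$. A unilateral weighted shift $W_\omega$ with bounded positive weights $\omega=\{\omega_n\}$ acts on $\ell^2(\mathbb{Z}_+)$ by $W_\omega e_n=\omega_ne_{n+1}$; its moments are $\gamma_0=1$, $\gamma_k=\omega_0^2\cdots\omega_{k-1}^2$. $W_\omega$ is subnormal iff there is a probability measure $\sigma$ on $[0,\|W_\omega\|^2]$ (its Berger measure) with $\gamma_k=\int r^kd\sigma(r)$ for all $k\ge0$. A $2$-variable weighted shift $W_{(\alpha,\beta)}\equiv(T_1,T_2)$, with bounded positive weights $\alpha_{\mathbf k},\beta_{\mathbf k}$ ($\mathbf k\in\mathbb{Z}_+^2$), acts on $\ell^2(\mathbb{Z}_+^2)$ by $T_1e_{\mathbf k}=\alpha_{\mathbf k}e_{\mathbf k+(1,0)}$, $T_2e_{\mathbf k}=\beta_{\mathbf k}e_{\mathbf k+(0,1)}$,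 and is assumed commuting. Its moment $\gamma_{(k_1,k_2)}$ is the product of the squares of the weights along any nondecreasing lattice path from $(0,0)$ to $(k_1,k_2)$. It is (jointly) subnormal iff there is a probability measure $\mu$ on $[0,\|T_1\|^2]\times[0,\|T_2\|^2]$ (its Berger measure) with $\gamma_{(k_1,k_2)}=\int s^{k_1}t^{k_2}d\mu(s,t)$ for all $k_1,k_2\ge0$. Polynomial embedding: let $I\subseteq\mathbb{R}_+$ be a closed interval, $p,q$ real polynomials nonnegative on $I$ such that $f=(p,q):I\to\mathbb{R}_+^2$ is injective, and let $W_\omega$ be subnormal with Berger measure $\sigma$, $\operatorname{supp}\sigma\subseteq I$. The $(p,q)$-embedding of $W_\omega$, denoted $W_{(\alpha(\omega),\beta(\omega))}$, is the $2$-variable weighted shift with moments $\gamma_{(k_1,k_2)}=\int_I p(r)^{k_1}q(r)^{k_2}\,d\sigma(r)$, $k_1,k_2\ge0$. *)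

theory Defs
  imports "HOL-Probability.Probability" "HOL-Computational_Algebra.Polynomial"
begin

definition ell2 :: "('i \<Rightarrow> complex) set" where
  "ell2 = {x. (\<lambda>k. (cmod (x k))\<^sup>2) summable_on UNIV}"

definition ell2_norm :: "('i \<Rightarrow> complex) \<Rightarrow> real" where
  "ell2_norm x = sqrt (\<Sum>\<^sub>\<infinity>k. (cmod (x k))\<^sup>2)"

definition ell2_basis :: "'i \<Rightarrow> 'i \<Rightarrow> complex" where
  "ell2_basis k = (\<lambda>j. if j = k then 1 else 0)"

text \<open>Only meaningful for bounded operators, since it is a supremum in the reals.\<close>

definition op_norm :: "(('i \<Rightarrow> complex) \<Rightarrow> ('i \<Rightarrow> complex)) \<Rightarrow> real" where
  "op_norm T = Sup {ell2_norm (T x) |x. x \<in> ell2 \<and> ell2_norm x \<le> 1}"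

definition bounded_positive_weights :: "('i \<Rightarrow> real) \<Rightarrow> bool" where
  "bounded_positive_weights w \<longleftrightarrow> (\<forall>k. 0 < w k) \<and> bdd_above (range w)"

definition weighted_shift :: "(nat \<Rightarrow> real) \<Rightarrow> (nat \<Rightarrow> complex) \<Rightarrow> (nat \<Rightarrow> complex)" where
  "weighted_shift \<omega> x = (\<lambda>n. case n of 0 \<Rightarrow> 0 | Suc m \<Rightarrow> complex_of_real (\<omega> m) * x m)"

lemma weighted_shift_basis:
  "weighted_shift \<omega> (ell2_basis n) = (\<lambda>j. complex_of_real (\<omega> n) * ell2_basis (Suc n) j)"
  by (auto simp: weighted_shift_def ell2_basis_def fun_eq_iff split: nat.split)

definition shift_moment :: "(nat \<Rightarrow> real) \<Rightarrow> nat \<Rightarrow> real" where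
  "shift_moment \<omega> k = (\<Prod>i<k. (\<omega> i)\<^sup>2)"

text \<open>A measure on \<open>[0, \<parallel>W\<parallel>\<^sup>2]\<close> is represented by a Borel measure on the line that gives the
  complement of that interval measure zero; likewise for rectangles in the plane below. A weighted
  shift is subnormal exactly when it has a Berger measure.\<close>

definition is_Berger_measure :: "(nat \<Rightarrow> real) \<Rightarrow> real measure \<Rightarrow> bool" where
  "is_Berger_measure \<omega> \<sigma> \<longleftrightarrow>
     prob_space \<sigma> \<and> sets \<sigma> = sets borel \<and>
     emeasure \<sigma> (- {0..(op_norm (weighted_shift \<omega>))\<^sup>2}) = 0 \<and>
     (\<forall>k. integrable \<sigma> (\<lambda>r. r ^ k) \<and> shift_moment \<omega> k = (LINT r|\<sigma>. r ^ k))"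

definition shift1 :: "(nat \<times> nat \<Rightarrow> real) \<Rightarrow> (nat \<times> nat \<Rightarrow> complex) \<Rightarrow> (nat \<times> nat \<Rightarrow> complex)" where
  "shift1 \<alpha> x = (\<lambda>(i, j). case i of 0 \<Rightarrow> 0 | Suc m \<Rightarrow> complex_of_real (\<alpha> (m, j)) * x (m, j))"

definition shift2 :: "(nat \<times> nat \<Rightarrow> real) \<Rightarrow> (nat \<times> nat \<Rightarrow> complex) \<Rightarrow> (nat \<times> nat \<Rightarrow> complex)" where
  "shift2 \<beta> x = (\<lambda>(i, j). case j of 0 \<Rightarrow> 0 | Suc m \<Rightarrow> complex_of_real (\<beta> (i, m)) * x (i, m))"

lemma shift1_basis:
  "shift1 \<alpha> (ell2_basis (i, j)) = (\<lambda>k. complex_of_real (\<alpha> (i, j)) * ell2_basis (Suc i, j) k)"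
  by (auto simp: shift1_def ell2_basis_def fun_eq_iff split: nat.split)

lemma shift2_basis:
  "shift2 \<beta> (ell2_basis (i, j)) = (\<lambda>k. complex_of_real (\<beta> (i, j)) * ell2_basis (i, Suc j) k)"
  by (auto simp: shift2_def ell2_basis_def fun_eq_iff split: nat.split)

definition two_variable_weighted_shift ::
    "(nat \<times> nat \<Rightarrow> real) \<Rightarrow> (nat \<times> nat \<Rightarrow> real) \<Rightarrow> bool" where
  "two_variable_weighted_shift \<alpha> \<beta> \<longleftrightarrow>
     bounded_positive_weights \<alpha> \<and> bounded_positive_weights \<beta> \<and>
     (\<forall>x\<in>ell2. shift1 \<alpha> (shift2 \<beta> x) = shift2 \<beta> (shift1 \<alpha> x))"

text \<open>The path first runs horizontally, then vertically; lemma \<open>path_weight_eq_shift_moment2\<close>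
  shows that every nondecreasing lattice path gives the same value.\<close>

definition shift_moment2 ::
    "(nat \<times> nat \<Rightarrow> real) \<Rightarrow> (nat \<times> nat \<Rightarrow> real) \<Rightarrow> nat \<Rightarrow> nat \<Rightarrow> real" where
  "shift_moment2 \<alpha> \<beta> k1 k2 = (\<Prod>i<k1. (\<alpha> (i, 0))\<^sup>2) * (\<Prod>j<k2. (\<beta> (k1, j))\<^sup>2)"

inductive path_weight ::
    "(nat \<times> nat \<Rightarrow> real) \<Rightarrow> (nat \<times> nat \<Rightarrow> real) \<Rightarrow> nat \<Rightarrow> nat \<Rightarrow> real \<Rightarrow> bool"
  for \<alpha> \<beta> where
  origin: "path_weight \<alpha> \<beta> 0 0 1"
| right: "path_weight \<alpha> \<beta> i j w \<Longrightarrow> path_weight \<alpha> \<beta> (Suc i) j (w * (\<alpha> (i, j))\<^sup>2)"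
| up: "path_weight \<alpha> \<beta> i j w \<Longrightarrow> path_weight \<alpha> \<beta> i (Suc j) (w * (\<beta> (i, j))\<^sup>2)"

lemma ell2_basis_in_ell2: "ell2_basis k \<in> ell2"
proof -
  have "(\<lambda>j. (cmod (ell2_basis k j))\<^sup>2) summable_on {k}"
    by simp
  then have "(\<lambda>j. (cmod (ell2_basis k j))\<^sup>2) summable_on UNIV"
    by (rule summable_on_cong_neutral[THEN iffD1, rotated -1]) (auto simp: ell2_basis_def)
  then show ?thesis
    by (simp add: ell2_def)
qed

lemma two_variable_weighted_shift_commute:
  assumes "two_variable_weighted_shift \<alpha> \<beta>"
  shows "\<beta> (Suc i, j) * \<alpha> (i, j) = \<alpha> (i, Suc j) * \<beta> (i, j)"
proof -
  have "shift1 \<alpha> (shift2 \<beta> (ell2_basis (i, j))) (Suc i, Suc j) =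
        shift2 \<beta> (shift1 \<alpha> (ell2_basis (i, j))) (Suc i, Suc j)"
    using assms ell2_basis_in_ell2 by (metis two_variable_weighted_shift_def)
  then have "complex_of_real (\<alpha> (i, Suc j) * \<beta> (i, j)) = complex_of_real (\<beta> (Suc i, j) * \<alpha> (i, j))"
    by (simp add: shift1_def shift2_def ell2_basis_def)
  then show ?thesis
    by (metis of_real_eq_iff)
qed

lemma path_weight_eq_shift_moment2:
  assumes "two_variable_weighted_shift \<alpha> \<beta>" and "path_weight \<alpha> \<beta> k1 k2 w"
  shows "w = shift_moment2 \<alpha> \<beta> k1 k2"
  using assms(2)
proof induction
  case origin
  show ?case by (simp add: shift_moment2_def)
next
  case (right i j w)
  have comm: "(\<beta> (Suc i, n))\<^sup>2 * (\<alpha> (i, n))\<^sup>2 = (\<alpha> (i, Suc n))\<^sup>2 * (\<beta> (i, n))\<^sup>2" for n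
    using two_variable_weighted_shift_commute[OF assms(1), of i n]
    by (metis power_mult_distrib)
  have "(\<Prod>n<j. (\<beta> (i, n))\<^sup>2) * (\<alpha> (i, j))\<^sup>2 = (\<alpha> (i, 0))\<^sup>2 * (\<Prod>n<j. (\<beta> (Suc i, n))\<^sup>2)"
  proof (induction j)
    case 0
    show ?case by simp
  next
    case (Suc j)
    have "(\<Prod>n<Suc j. (\<beta> (i, n))\<^sup>2) * (\<alpha> (i, Suc j))\<^sup>2
        = (\<Prod>n<j. (\<beta> (i, n))\<^sup>2) * ((\<alpha> (i, Suc j))\<^sup>2 * (\<beta> (i, j))\<^sup>2)"
      by (simp add: mult_ac)
    also have "\<dots> = ((\<Prod>n<j. (\<beta> (i, n))\<^sup>2) * (\<alpha> (i, j))\<^sup>2) * (\<beta> (Suc i, j))\<^sup>2"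
      by (simp only: comm[symmetric]) (simp only: mult_ac)
    also have "\<dots> = (\<alpha> (i, 0))\<^sup>2 * (\<Prod>n<Suc j. (\<beta> (Suc i, n))\<^sup>2)"
      by (simp only: Suc.IH prod.lessThan_Suc mult.assoc)
    finally show ?case .
  qed
  then show ?case
    using right.IH by (simp add: shift_moment2_def mult.assoc)
next
  case (up i j w)
  then show ?case by (simp add: shift_moment2_def mult_ac)
qed

definition is_Berger_measure2 ::
    "(nat \<times> nat \<Rightarrow> real) \<Rightarrow> (nat \<times> nat \<Rightarrow> real) \<Rightarrow> (real \<times> real) measure \<Rightarrow> bool" where
  "is_Berger_measure2 \<alpha> \<beta> \<mu> \<longleftrightarrow>
     prob_space \<mu> \<and> sets \<mu> = sets borel \<and>
     emeasure \<mu> (- ({0..(op_norm (shift1 \<alpha>))\<^sup>2} \<times> {0..(op_norm (shift2 \<beta>))\<^sup>2})) = 0 \<and>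
     (\<forall>k1 k2. integrable \<mu> (\<lambda>(s, t). s ^ k1 * t ^ k2) \<and>
        shift_moment2 \<alpha> \<beta> k1 k2 = (LINT (s, t)|\<mu>. s ^ k1 * t ^ k2))"

definition measure_support :: "'a::topological_space measure \<Rightarrow> 'a set" where
  "measure_support M = {x. \<forall>U. open U \<and> x \<in> U \<longrightarrow> emeasure M U \<noteq> 0}"

definition polynomial_embedding ::
    "real poly \<Rightarrow> real poly \<Rightarrow> real set \<Rightarrow> (nat \<Rightarrow> real) \<Rightarrow> real measure \<Rightarrow>
     (nat \<times> nat \<Rightarrow> real) \<Rightarrow> (nat \<times> nat \<Rightarrow> real) \<Rightarrow> bool" where
  "polynomial_embedding p q I \<omega> \<sigma> \<alpha> \<beta> \<longleftrightarrow>
     is_interval I \<and> closed I \<and> I \<subseteq> {0..} \<and>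
     (\<forall>r\<in>I. 0 \<le> poly p r \<and> 0 \<le> poly q r) \<and>
     inj_on (\<lambda>r. (poly p r, poly q r)) I \<and>
     bounded_positive_weights \<omega> \<and> is_Berger_measure \<omega> \<sigma> \<and> measure_support \<sigma> \<subseteq> I \<and>
     two_variable_weighted_shift \<alpha> \<beta> \<and>
     (\<forall>k1 k2. set_integrable \<sigma> I (\<lambda>r. poly p r ^ k1 * poly q r ^ k2) \<and>
        shift_moment2 \<alpha> \<beta> k1 k2 = (LINT r:I|\<sigma>. poly p r ^ k1 * poly q r ^ k2))"

text \<open>The measure \<open>\<Sum>i<l. \<rho> i \<cdot> \<delta>(x i)\<close>; here \<open>return borel a\<close> is the point mass at \<open>a\<close>.
  Negative \<open>\<rho> i\<close> would be truncated to zero by \<open>ennreal\<close>.\<close>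

definition atomic_measure :: "nat \<Rightarrow> (nat \<Rightarrow> real) \<Rightarrow> (nat \<Rightarrow> 'a::topological_space) \<Rightarrow> 'a measure" where
  "atomic_measure l \<rho> x =
     measure_of UNIV (sets borel) (\<lambda>A. \<Sum>i<l. ennreal (\<rho> i) * emeasure (return borel (x i)) A)"

lemma sets_atomic_measure: "sets (atomic_measure l \<rho> x) = sets borel"
  unfolding atomic_measure_def by (metis sets.sets_measure_of_eq space_borel)

lemma emeasure_atomic_measure:
  assumes "A \<in> sets borel"
  shows "emeasure (atomic_measure l \<rho> x) A
       = (\<Sum>i<l. ennreal (\<rho> i) * emeasure (return borel (x i)) A)"
proof (rule emeasure_measure_of[OF atomic_measure_def])
  show "sets borel \<subseteq> Pow (UNIV :: 'a set)"
    by simp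
  show "A \<in> sets (atomic_measure l \<rho> x)"
    using assms by (simp add: sets_atomic_measure)
  show "positive (sets (atomic_measure l \<rho> x))
          (\<lambda>A. \<Sum>i<l. ennreal (\<rho> i) * emeasure (return borel (x i)) A)"
    by (simp add: positive_def)
  show "countably_additive (sets (atomic_measure l \<rho> x))
          (\<lambda>A. \<Sum>i<l. ennreal (\<rho> i) * emeasure (return borel (x i)) A)"
  proof (rule countably_additiveI)
    fix F :: "nat \<Rightarrow> 'a set"
    assume F: "range F \<subseteq> sets (atomic_measure l \<rho> x)" "disjoint_family F"
    have "(\<Sum>n. \<Sum>i<l. ennreal (\<rho> i) * emeasure (return borel (x i)) (F n))
        = (\<Sum>i<l. \<Sum>n. ennreal (\<rho> i) * emeasure (return borel (x i)) (F n))"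
      by (intro suminf_sum) simp
    also have "\<dots> = (\<Sum>i<l. ennreal (\<rho> i) * emeasure (return borel (x i)) (\<Union>n. F n))"
    proof (intro sum.cong refl)
      fix i
      have "(\<Sum>n. emeasure (return borel (x i)) (F n)) = emeasure (return borel (x i)) (\<Union>n. F n)"
        using F by (intro suminf_emeasure) (simp_all add: sets_atomic_measure)
      then show "(\<Sum>n. ennreal (\<rho> i) * emeasure (return borel (x i)) (F n))
          = ennreal (\<rho> i) * emeasure (return borel (x i)) (\<Union>n. F n)"
        by (simp only: ennreal_suminf_cmult)
    qed
    finally show "(\<Sum>n. \<Sum>i<l. ennreal (\<rho> i) * emeasure (return borel (x i)) (F n))
        = (\<Sum>i<l. ennreal (\<rho> i) * emeasure (return borel (x i)) (\<Union>n. F n))" .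
  qed
qed

end

theory Submission
  imports Defs
begin

text \<open>
  Put \<open>x i = (poly p (r i), poly q (r i))\<close> and let \<open>\<nu>\<close> carry the mass \<open>\<rho> i\<close> at \<open>x i\<close>. Each \<open>r i\<close>
  has positive mass, so it lies in the support of \<open>\<sigma>\<close> and hence in \<open>I\<close>; the integrals over \<open>I\<close> that
  define the moments of the embedding are therefore exactly the moments of \<open>\<nu>\<close>. What remains is that
  \<open>\<nu>\<close> lives on the right rectangle and that no other measure has the same moments.

  The rectangle: the norm of a coordinate shift \<open>T\<close> dominates each of its weights
  (\<open>weight_le_op_norm\<close>), so the \<open>k\<close>-th moment along an axis is at most \<open>(\<parallel>T\<parallel>\<^sup>2) ^ k\<close>. It is also at
  least \<open>\<rho> i * a ^ k\<close>, where \<open>a\<close> is the coordinate of \<open>x i\<close> along that axis. Letting \<open>k\<close> grow gives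
  \<open>a \<le> \<parallel>T\<parallel>\<^sup>2\<close>.

  Uniqueness: a measure \<open>\<mu>\<close> with the moments of \<open>\<nu>\<close> integrates every polynomial as \<open>\<nu>\<close> does
  (\<open>same_polynomial_integrals_if_same_moments\<close>). The polynomial \<open>\<Prod>i. \<parallel>y - x i\<parallel>\<^sup>2\<close> is nonnegative and
  has \<open>\<nu>\<close>-integral zero, so \<open>\<mu>\<close> is concentrated on its zeros, the points \<open>x i\<close>. Injectivity of the
  embedding makes these points distinct, so omitting the factor of index \<open>j\<close> leaves a polynomial which
  on the atoms vanishes precisely away from \<open>x j\<close>; its integral identifies the mass of \<open>\<mu>\<close> at \<open>x j\<close>
  as \<open>\<rho> j\<close> (\<open>atomic_measure_unique\<close>).
\<close>

section \<open>Integration against finitely atomic measures\<close>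

text \<open>Viewing the measure as the image of a weighted index set turns integrals into finite sums, even
  when some of the points coincide.\<close>

lemma atomic_measure_eq_distr:
  "atomic_measure l \<rho> x = distr (point_measure {..<l} (\<lambda>i. ennreal (\<rho> i))) borel x"
proof (rule measure_eqI)
  fix A :: "'a set" assume "A \<in> sets (atomic_measure l \<rho> x)"
  then have A: "A \<in> sets borel" by (simp add: sets_atomic_measure)
  have "emeasure (distr (point_measure {..<l} (\<lambda>i. ennreal (\<rho> i))) borel x) A
      = (\<Sum>i\<in>x -` A \<inter> {..<l}. ennreal (\<rho> i))"
    using A by (simp add: emeasure_distr space_point_measure emeasure_point_measure_finite)
  also have "\<dots> = (\<Sum>i<l. ennreal (\<rho> i) * emeasure (return borel (x i)) A)"
    using A by (intro sum.mono_neutral_cong_left) (auto simp: indicator_def)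
  finally show "emeasure (atomic_measure l \<rho> x) A
      = emeasure (distr (point_measure {..<l} (\<lambda>i. ennreal (\<rho> i))) borel x) A"
    using A by (simp add: emeasure_atomic_measure)
qed (simp add: sets_atomic_measure)

lemma integrable_atomic_measure:
  fixes f :: "'a::topological_space \<Rightarrow> real"
  assumes "f \<in> borel_measurable borel"
  shows "integrable (atomic_measure l \<rho> x) f"
  using assms by (simp add: atomic_measure_eq_distr integrable_distr_eq integrable_point_measure_finite)

lemma integral_atomic_measure:
  fixes f :: "'a::topological_space \<Rightarrow> real"
  assumes "f \<in> borel_measurable borel" and "\<And>i. i < l \<Longrightarrow> 0 \<le> \<rho> i"
  shows "(LINT y|atomic_measure l \<rho> x. f y) = (\<Sum>i<l. \<rho> i * f (x i))"
proof -
  have "(LINT y|atomic_measure l \<rho> x. f y) = (LINT i|point_measure {..<l} (\<lambda>i. ennreal (\<rho> i)). f (x i))"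
    using assms(1) by (simp add: atomic_measure_eq_distr integral_distr)
  also have "\<dots> = (\<Sum>i<l. \<rho> i * f (x i))"
    using assms(2) by (subst lebesgue_integral_point_measure_finite) auto
  finally show ?thesis .
qed

lemma prob_space_atomic_measure:
  fixes x :: "nat \<Rightarrow> 'a::topological_space"
  assumes "\<And>i. i < l \<Longrightarrow> 0 \<le> \<rho> i" and "(\<Sum>i<l. \<rho> i) = 1"
  shows "prob_space (atomic_measure l \<rho> x)"
proof
  have "space (atomic_measure l \<rho> x) = UNIV"
    using sets_eq_imp_space_eq[OF sets_atomic_measure[of l \<rho> x]] by simp
  moreover have "(\<Sum>i<l. ennreal (\<rho> i)) = 1"
    using assms by (subst sum_ennreal) auto
  ultimately show "emeasure (atomic_measure l \<rho> x) (space (atomic_measure l \<rho> x)) = 1"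
    by (simp add: emeasure_atomic_measure)
qed

lemma atom_in_measure_support:
  assumes "i < l" and "0 < \<rho> i"
  shows "x i \<in> measure_support (atomic_measure l \<rho> x)"
proof -
  have "emeasure (atomic_measure l \<rho> x) U \<noteq> 0" if "open U" "x i \<in> U" for U
    using assms that by (auto simp: emeasure_atomic_measure ennreal_eq_0_iff)
  then show ?thesis by (auto simp: measure_support_def)
qed

section \<open>Finitely atomic measures are determined by their moments\<close>

text \<open>Multiplying by a fixed polynomial preserves the class of functions all of whose monomial
  multiples have equal integrals: this property of the multiplier is inherited by sums and products,
  which makes induction over polynomial functions possible.\<close>

lemma same_polynomial_integrals_if_same_moments:
  fixes M N :: "(real \<times> real) measure"
  assumes M: "\<And>i j. integrable M (\<lambda>(s, t). s ^ i * t ^ j)"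
    and N: "\<And>i j. integrable N (\<lambda>(s, t). s ^ i * t ^ j)"
    and eq: "\<And>i j. (LINT (s, t)|M. s ^ i * t ^ j) = (LINT (s, t)|N. s ^ i * t ^ j)"
    and "real_polynomial_function h"
  shows "integrable M h \<and> integrable N h \<and> (LINT y|M. h y) = (LINT y|N. h y)"
proof -
  define same where "same g \<longleftrightarrow> integrable M g \<and> integrable N g \<and> (LINT y|M. g y) = (LINT y|N. g y)"
    for g :: "real \<times> real \<Rightarrow> real"
  define stable where "stable g \<longleftrightarrow> (\<forall>i j. same (\<lambda>y. fst y ^ i * snd y ^ j * g y))"
    for g :: "real \<times> real \<Rightarrow> real"
  have same_add: "same (\<lambda>y. f y + g y)" if "same f" "same g" for f g
    using that by (simp add: same_def)
  have same_scale: "same (\<lambda>y. c * f y)" if "same f" for c f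
    using that by (simp add: same_def)
  have stable_add: "stable (\<lambda>y. f y + g y)" if "stable f" "stable g" for f g
    using that by (auto simp: stable_def distrib_left intro!: same_add)
  have stable_scale: "stable (\<lambda>y. c * f y)" if "stable f" for c f
    unfolding stable_def
  proof (intro allI)
    fix i j
    have "same (\<lambda>y. c * (fst y ^ i * snd y ^ j * f y))"
      using that by (intro same_scale) (simp add: stable_def)
    then show "same (\<lambda>y. fst y ^ i * snd y ^ j * (c * f y))"
      by (simp add: mult_ac)
  qed
  have stable_fst: "stable (\<lambda>y. fst y * f y)" if "stable f" for f
    unfolding stable_def
  proof (intro allI)
    fix i j
    have "same (\<lambda>y. fst y ^ Suc i * snd y ^ j * f y)"
      using that unfolding stable_def by blast
    then show "same (\<lambda>y. fst y ^ i * snd y ^ j * (fst y * f y))"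
      by (simp add: mult_ac)
  qed
  have stable_snd: "stable (\<lambda>y. snd y * f y)" if "stable f" for f
    unfolding stable_def
  proof (intro allI)
    fix i j
    have "same (\<lambda>y. fst y ^ i * snd y ^ Suc j * f y)"
      using that unfolding stable_def by blast
    then show "same (\<lambda>y. fst y ^ i * snd y ^ j * (snd y * f y))"
      by (simp add: mult_ac)
  qed
  have "stable g \<Longrightarrow> stable (\<lambda>y. h y * g y)" for g
    using assms(4)
  proof (induction arbitrary: g rule: real_polynomial_function.induct)
    case (linear f)
    then interpret bounded_linear f by simp
    have "f y = f (1, 0) * fst y + f (0, 1) * snd y" for y
    proof -
      have "f y = f (fst y *\<^sub>R (1, 0) + snd y *\<^sub>R (0, 1))"
        by (cases y) simp
      then show ?thesis by (simp only: add scale) (simp add: mult.commute)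
    qed
    then have "(\<lambda>y. f y * g y) = (\<lambda>y. f (1, 0) * (fst y * g y) + f (0, 1) * (snd y * g y))"
      by (metis (no_types, opaque_lifting) distrib_right mult.assoc)
    then show ?case
      using linear.prems by (auto intro!: stable_add stable_scale stable_fst stable_snd)
  next
    case (const c)
    then show ?case by (rule stable_scale)
  next
    case (add f1 f2)
    then show ?case by (simp add: distrib_right stable_add)
  next
    case (mult f1 f2)
    then show ?case by (simp add: mult.assoc)
  qed
  moreover have "stable (\<lambda>_. 1)"
    using M N eq by (simp add: stable_def same_def case_prod_beta')
  ultimately have "stable (\<lambda>y. h y * 1)" by blast
  then have "same (\<lambda>y. fst y ^ 0 * snd y ^ 0 * (h y * 1))"
    unfolding stable_def by blast
  then show ?thesis by (simp add: same_def)
qed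

lemma real_polynomial_function_prod_dist2:
  fixes x :: "'i \<Rightarrow> 'a::euclidean_space"
  assumes "finite J"
  shows "real_polynomial_function (\<lambda>y. \<Prod>i\<in>J. (y - x i) \<bullet> (y - x i))"
proof -
  have "real_polynomial_function (\<lambda>y. (y - a) \<bullet> (y - a))" for a :: 'a
  proof -
    have "real_polynomial_function (\<lambda>y. (y - a) \<bullet> b)" for b
      unfolding inner_diff_left
      by (intro real_polynomial_function_diff real_polynomial_function.intros(1)
          real_polynomial_function.intros(2) bounded_linear_inner_left)
    then have "real_polynomial_function (\<lambda>y. \<Sum>b\<in>Basis. ((y - a) \<bullet> b) * ((y - a) \<bullet> b))"
      by (intro real_polynomial_function_sum real_polynomial_function.intros(4)) auto
    then show ?thesis
      by (simp only: euclidean_inner[symmetric])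
  qed
  then show ?thesis
    using assms by (intro real_polynomial_function_prod) auto
qed

text \<open>Products of squared distances to the atoms serve as test polynomials: the full product confines
  the mass to the atoms, and the product without one factor isolates one atom.\<close>

lemma atomic_measure_unique:
  fixes M :: "'a::euclidean_space measure"
  assumes sets: "sets M = sets borel" and "finite_measure M"
    and pos: "\<And>i. i < l \<Longrightarrow> 0 \<le> \<rho> i" and inj: "inj_on x {..<l}"
    and same: "\<And>h. real_polynomial_function h \<Longrightarrow>
      integrable M h \<and> (LINT y|M. h y) = (LINT y|atomic_measure l \<rho> x. h y)"
  shows "M = atomic_measure l \<rho> x"
proof -
  interpret finite_measure M by fact
  define D where "D J y = (\<Prod>i\<in>J. (y - x i) \<bullet> (y - x i))" for J and y :: 'a
  have D_zero: "D J y = 0 \<longleftrightarrow> y \<in> x ` J" if "finite J" for J y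
    using that by (auto simp: D_def)
  have D_nonneg: "0 \<le> D J y" for J y
    by (auto simp: D_def intro: prod_nonneg)
  have D_int: "integrable M (D J)" "(LINT y|M. D J y) = (\<Sum>i<l. \<rho> i * D J (x i))"
    if "finite J" for J
  proof -
    have poly: "real_polynomial_function (D J)"
      unfolding D_def[abs_def] using that by (rule real_polynomial_function_prod_dist2)
    then have "D J \<in> borel_measurable borel"
      by (intro borel_measurable_continuous_onI continuous_on_polymonial_function)
        (simp add: real_polynomial_function_eq)
    then show "integrable M (D J)" "(LINT y|M. D J y) = (\<Sum>i<l. \<rho> i * D J (x i))"
      using same[OF poly] pos by (simp_all add: integral_atomic_measure)
  qed
  have "(\<Sum>i<l. \<rho> i * D {..<l} (x i)) = 0"
    by (intro sum.neutral) (simp add: D_zero)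
  then have "AE y in M. D {..<l} y = 0"
    using integral_nonneg_eq_0_iff_AE[of M "D {..<l}"] D_int[of "{..<l}"] D_nonneg by simp
  then have AE: "AE y in M. y \<in> x ` {..<l}"
    by (simp add: D_zero)
  have mass: "emeasure M {x j} = ennreal (\<rho> j)" if j: "j < l" for j
  proof -
    let ?J = "{..<l} - {j}"
    have off: "x j \<notin> x ` ?J"
      using inj j by (auto dest: inj_onD)
    have single: "D ?J y = D ?J (x j) * indicator {x j} y" if "y \<in> x ` {..<l}" for y
      using that by (auto simp: indicator_def D_zero)
    have "(LINT y|M. D ?J y) = (LINT y|M. D ?J (x j) * indicator {x j} y)"
    proof (rule integral_cong_AE)
      show "AE y in M. D ?J y = D ?J (x j) * indicator {x j} y"
        using AE by (rule eventually_mono) (rule single)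
      show "D ?J \<in> borel_measurable M"
        using D_int(1)[of ?J] by simp
      have "{x j} \<in> sets M" by (simp add: sets)
      then show "(\<lambda>y. D ?J (x j) * indicator {x j} y) \<in> borel_measurable M"
        by simp
    qed
    also have "\<dots> = D ?J (x j) * measure M {x j}"
      by (simp add: sets sets_eq_imp_space_eq[OF sets])
    finally have "D ?J (x j) * measure M {x j} = (\<Sum>i<l. \<rho> i * D ?J (x i))"
      by (simp add: D_int)
    also have "\<dots> = (\<Sum>i\<in>{j}. \<rho> i * D ?J (x i))"
      using j by (intro sum.mono_neutral_right) (auto simp: D_zero)
    finally have "measure M {x j} = \<rho> j"
      using off D_zero[of ?J "x j"] by simp
    then show ?thesis by (simp add: emeasure_eq_measure)
  qed
  show ?thesis
  proof (rule measure_eqI)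
    fix A assume "A \<in> sets M"
    then have A: "A \<in> sets borel" by (simp add: sets)
    let ?J = "{i. i < l \<and> x i \<in> A}"
    have "emeasure M A = emeasure M (x ` ?J)"
      using AE A by (intro emeasure_eq_AE) (auto simp: sets finite_imp_closed)
    also have "\<dots> = (\<Sum>y\<in>x ` ?J. emeasure M {y})"
      by (intro emeasure_eq_sum_singleton) (auto simp: sets)
    also have "\<dots> = (\<Sum>i\<in>?J. emeasure M {x i})"
      using inj by (intro sum.reindex_cong[of x]) (auto intro: inj_on_subset)
    also have "\<dots> = (\<Sum>i<l. ennreal (\<rho> i) * emeasure (return borel (x i)) A)"
      using A by (intro sum.mono_neutral_cong_left) (auto simp: mass)
    finally show "emeasure M A = emeasure (atomic_measure l \<rho> x) A"
      using A by (simp add: emeasure_atomic_measure)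
  qed (simp add: sets sets_atomic_measure)
qed

section \<open>Weights and the norm of a shift\<close>

lemma ell2_norm_basis: "ell2_norm (ell2_basis k) = 1"
proof -
  have "(\<Sum>\<^sub>\<infinity>j. (cmod (ell2_basis k j))\<^sup>2) = (\<Sum>\<^sub>\<infinity>j\<in>{k}. (cmod (ell2_basis k j))\<^sup>2)"
    by (rule infsum_cong_neutral) (auto simp: ell2_basis_def)
  then show ?thesis by (simp add: ell2_norm_def ell2_basis_def)
qed

text \<open>Both coordinate shifts move the basis along an injection \<open>f\<close> of the index set. Boundedness of
  the weights is essential here, as otherwise the supremum defining the norm is meaningless.\<close>

lemma weight_le_op_norm:
  fixes T :: "('i \<Rightarrow> complex) \<Rightarrow> ('i \<Rightarrow> complex)"
  assumes w: "bounded_positive_weights w" and f: "inj f"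
    and T: "\<And>x k. T x (f k) = complex_of_real (w k) * x k"
    and T0: "\<And>x n. n \<notin> range f \<Longrightarrow> T x n = 0"
  shows "w k \<le> op_norm T"
proof -
  obtain C where C: "\<And>k. w k \<le> C"
    using w by (auto simp: bounded_positive_weights_def bdd_above_def)
  have wpos: "0 < w k" for k
    using w by (simp add: bounded_positive_weights_def)
  have C0: "0 \<le> C" using C[of k] wpos[of k] by linarith
  have norm_T: "ell2_norm (T x) = sqrt (\<Sum>\<^sub>\<infinity>k. (w k)\<^sup>2 * (cmod (x k))\<^sup>2)" for x
  proof -
    have "(\<Sum>\<^sub>\<infinity>n. (cmod (T x n))\<^sup>2) = (\<Sum>\<^sub>\<infinity>n\<in>range f. (cmod (T x n))\<^sup>2)"
      by (rule infsum_cong_neutral) (auto simp: T0)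
    also have "\<dots> = (\<Sum>\<^sub>\<infinity>k. (cmod (T x (f k)))\<^sup>2)"
      using infsum_reindex[OF f, of "\<lambda>n. (cmod (T x n))\<^sup>2"] by (simp add: o_def)
    finally show ?thesis
      by (simp add: ell2_norm_def T norm_mult power_mult_distrib)
  qed
  have bound: "ell2_norm (T x) \<le> C" if x: "x \<in> ell2" "ell2_norm x \<le> 1" for x
  proof -
    have sx: "(\<lambda>k. (cmod (x k))\<^sup>2) summable_on UNIV" using x by (simp add: ell2_def)
    have le: "(w k)\<^sup>2 * (cmod (x k))\<^sup>2 \<le> C\<^sup>2 * (cmod (x k))\<^sup>2" for k
      using C[of k] wpos[of k] by (intro mult_right_mono power_mono) auto
    have sC: "(\<lambda>k. C\<^sup>2 * (cmod (x k))\<^sup>2) summable_on UNIV"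
      using sx by (rule summable_on_cmult_right)
    have "(\<lambda>k. (w k)\<^sup>2 * (cmod (x k))\<^sup>2) summable_on UNIV"
      using sC by (rule summable_on_comparison_test) (auto simp: le)
    then have "(\<Sum>\<^sub>\<infinity>k. (w k)\<^sup>2 * (cmod (x k))\<^sup>2) \<le> (\<Sum>\<^sub>\<infinity>k. C\<^sup>2 * (cmod (x k))\<^sup>2)"
      using sC by (rule infsum_mono) (rule le)
    also have "\<dots> = C\<^sup>2 * (\<Sum>\<^sub>\<infinity>k. (cmod (x k))\<^sup>2)"
      using sx by (intro infsum_cmult_right) auto
    finally have "ell2_norm (T x) \<le> sqrt (C\<^sup>2 * (\<Sum>\<^sub>\<infinity>k. (cmod (x k))\<^sup>2))"
      by (simp add: norm_T)
    also have "\<dots> = C * ell2_norm x"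
      using C0 by (simp add: ell2_norm_def real_sqrt_mult)
    also have "\<dots> \<le> C * 1" using C0 x by (intro mult_left_mono)
    finally show ?thesis by simp
  qed
  have "(\<Sum>\<^sub>\<infinity>j. (w j)\<^sup>2 * (cmod (ell2_basis k j))\<^sup>2) = (\<Sum>\<^sub>\<infinity>j\<in>{k}. (w j)\<^sup>2 * (cmod (ell2_basis k j))\<^sup>2)"
    by (rule infsum_cong_neutral) (auto simp: ell2_basis_def)
  then have "ell2_norm (T (ell2_basis k)) = w k"
    using wpos[of k] by (simp add: norm_T ell2_basis_def)
  then have "w k \<in> {ell2_norm (T x) |x. x \<in> ell2 \<and> ell2_norm x \<le> 1}"
    using ell2_basis_in_ell2[of k] ell2_norm_basis[of k] by (metis (mono_tags, lifting) mem_Collect_eq order_refl)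
  then show ?thesis
    unfolding op_norm_def using bound by (intro cSup_upper) (auto simp: bdd_above_def)
qed

lemma shift1_weight_le_op_norm:
  assumes "bounded_positive_weights \<alpha>"
  shows "\<alpha> k \<le> op_norm (shift1 \<alpha>)"
proof (rule weight_le_op_norm[where f = "\<lambda>(i, j). (Suc i, j)"])
  show "shift1 \<alpha> x n = 0" if "n \<notin> range (\<lambda>(i, j). (Suc i, j))" for x n
    using that by (cases n; cases "fst n") (auto simp: shift1_def image_iff)
qed (auto simp: assms inj_on_def shift1_def)

lemma shift2_weight_le_op_norm:
  assumes "bounded_positive_weights \<beta>"
  shows "\<beta> k \<le> op_norm (shift2 \<beta>)"
proof (rule weight_le_op_norm[where f = "\<lambda>(i, j). (i, Suc j)"])
  show "shift2 \<beta> x n = 0" if "n \<notin> range (\<lambda>(i, j). (i, Suc j))" for x n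
    using that by (cases n; cases "snd n") (auto simp: shift2_def image_iff)
qed (auto simp: assms inj_on_def shift2_def)

text \<open>An atom of mass \<open>c\<close> at \<open>a\<close> forces the moments to grow at least like \<open>a ^ k\<close>, whereas weights
  bounded by \<open>N\<close> allow at most the growth of \<open>(N\<^sup>2) ^ k\<close>.\<close>

lemma atom_le_weight_bound:
  fixes c a N :: real and w :: "nat \<Rightarrow> real"
  assumes "0 < c" and w: "\<And>j. 0 < w j" "\<And>j. w j \<le> N"
    and moment: "\<And>k. c * a ^ k \<le> (\<Prod>j<k. (w j)\<^sup>2)"
  shows "a \<le> N\<^sup>2"
proof (rule ccontr)
  assume "\<not> a \<le> N\<^sup>2"
  moreover have N: "0 < N" using w[of 0] by linarith
  ultimately have "1 < a / N\<^sup>2" by simp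
  then obtain k where "1 / c < (a / N\<^sup>2) ^ k"
    using real_arch_pow by blast
  then have "(N\<^sup>2) ^ k < c * a ^ k"
    using N \<open>0 < c\<close> by (simp add: power_divide field_simps)
  moreover have "(\<Prod>j<k. (w j)\<^sup>2) \<le> (\<Prod>j<k. N\<^sup>2)"
    using w by (intro prod_mono conjI power_mono) (auto intro: less_imp_le)
  ultimately show False using moment[of k] by simp
qed

section \<open>The Berger measure of a polynomial embedding\<close>

theorem theorem1p8:
  fixes p q :: "real poly" and I :: "real set"
    and \<omega> :: "nat \<Rightarrow> real" and \<sigma> :: "real measure"
    and \<alpha> \<beta> :: "nat \<times> nat \<Rightarrow> real"
    and l :: nat and \<rho> r :: "nat \<Rightarrow> real"
    and \<mu> :: "(real \<times> real) measure"
  assumes "polynomial_embedding p q I \<omega> \<sigma> \<alpha> \<beta>"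
    and "\<sigma> = atomic_measure l \<rho> r"
    and "l \<ge> 1"
    and "(\<Sum>i<l. \<rho> i) = 1"
    and "\<forall>i<l. 0 < \<rho> i"
    and "0 \<le> r 0"
    and "strict_mono_on {..<l} r"
  shows "is_Berger_measure2 \<alpha> \<beta> \<mu> \<longleftrightarrow> \<mu> = atomic_measure l \<rho> (\<lambda>i. (poly p (r i), poly q (r i)))"
proof -
  define x where "x i = (poly p (r i), poly q (r i))" for i
  let ?\<nu> = "atomic_measure l \<rho> x"
  note emb = assms(1)[unfolded polynomial_embedding_def]
  have pos: "0 < \<rho> i" if "i < l" for i using assms(5) that by simp
  have rI: "r i \<in> I" if "i < l" for i
    using atom_in_measure_support[of i l \<rho> r] pos[OF that] that emb assms(2) by auto
  have nonneg: "0 \<le> poly p (r i)" "0 \<le> poly q (r i)" if "i < l" for i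
    using emb rI[OF that] by auto
  have weights: "bounded_positive_weights \<alpha>" "bounded_positive_weights \<beta>"
    using emb by (auto simp: two_variable_weighted_shift_def)
  have meas: "(\<lambda>(s, t). s ^ k1 * t ^ k2) \<in> borel_measurable (borel :: (real \<times> real) measure)" for k1 k2
    by (intro borel_measurable_continuous_onI) (auto simp: case_prod_beta' intro!: continuous_intros)
  have moment: "shift_moment2 \<alpha> \<beta> k1 k2 = (\<Sum>i<l. \<rho> i * (poly p (r i) ^ k1 * poly q (r i) ^ k2))" for k1 k2
  proof -
    have "I \<in> sets borel" using emb by auto
    moreover have "(\<lambda>y. poly p y ^ k1 * poly q y ^ k2) \<in> borel_measurable borel"
      by (intro borel_measurable_continuous_onI continuous_intros)
    ultimately have "(\<lambda>y. indicator I y *\<^sub>R (poly p y ^ k1 * poly q y ^ k2)) \<in> borel_measurable borel"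
      by (intro borel_measurable_scaleR borel_measurable_indicator)
    then have "(LINT y:I|\<sigma>. poly p y ^ k1 * poly q y ^ k2)
        = (\<Sum>i<l. \<rho> i * (indicator I (r i) *\<^sub>R (poly p (r i) ^ k1 * poly q (r i) ^ k2)))"
      unfolding set_lebesgue_integral_def assms(2)
      by (intro integral_atomic_measure) (auto intro: less_imp_le pos)
    also have "\<dots> = (\<Sum>i<l. \<rho> i * (poly p (r i) ^ k1 * poly q (r i) ^ k2))"
      by (intro sum.cong) (auto simp: rI)
    finally show ?thesis using emb by simp
  qed
  have \<nu>_int: "integrable ?\<nu> (\<lambda>(s, t). s ^ k1 * t ^ k2)" for k1 k2
    using meas by (rule integrable_atomic_measure)
  have \<nu>_moment: "(LINT (s, t)|?\<nu>. s ^ k1 * t ^ k2) = shift_moment2 \<alpha> \<beta> k1 k2" for k1 k2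
    using integral_atomic_measure[OF meas, of l \<rho> x k1 k2] pos
    by (simp add: moment x_def less_imp_le)
  have prob: "prob_space ?\<nu>"
    using pos assms(4) by (intro prob_space_atomic_measure) (auto intro: less_imp_le)
  have term_le: "\<rho> i * (poly p (r i) ^ k1 * poly q (r i) ^ k2) \<le> shift_moment2 \<alpha> \<beta> k1 k2"
    if "i < l" for i k1 k2
    unfolding moment using that pos nonneg
    by (intro member_le_sum) (auto intro!: mult_nonneg_nonneg intro: less_imp_le)
  have p_le: "poly p (r i) \<le> (op_norm (shift1 \<alpha>))\<^sup>2" if "i < l" for i
  proof (rule atom_le_weight_bound[where w = "\<lambda>j. \<alpha> (j, 0)", OF pos[OF that]])
    show "\<rho> i * poly p (r i) ^ k \<le> (\<Prod>j<k. (\<alpha> (j, 0))\<^sup>2)" for k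
      using term_le[OF that, of k 0] by (simp add: shift_moment2_def)
  qed (use weights in \<open>auto simp: bounded_positive_weights_def intro: shift1_weight_le_op_norm\<close>)
  have q_le: "poly q (r i) \<le> (op_norm (shift2 \<beta>))\<^sup>2" if "i < l" for i
  proof (rule atom_le_weight_bound[where w = "\<lambda>j. \<beta> (0, j)", OF pos[OF that]])
    show "\<rho> i * poly q (r i) ^ k \<le> (\<Prod>j<k. (\<beta> (0, j))\<^sup>2)" for k
      using term_le[OF that, of 0 k] by (simp add: shift_moment2_def)
  qed (use weights in \<open>auto simp: bounded_positive_weights_def intro: shift2_weight_le_op_norm\<close>)
  let ?R = "{0..(op_norm (shift1 \<alpha>))\<^sup>2} \<times> {0..(op_norm (shift2 \<beta>))\<^sup>2}"
  have "- ?R \<in> sets borel"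
    by (intro borel_open open_Compl closed_Times closed_atLeastAtMost)
  then have "emeasure ?\<nu> (- ?R) = 0"
    using p_le q_le nonneg by (simp add: emeasure_atomic_measure x_def)
  then have Berger: "is_Berger_measure2 \<alpha> \<beta> ?\<nu>"
    using prob \<nu>_int \<nu>_moment by (simp add: is_Berger_measure2_def sets_atomic_measure)
  have inj: "inj_on x {..<l}"
  proof -
    have "inj_on r {..<l}"
      using assms(7) by (rule strict_mono_on_imp_inj_on)
    moreover have "inj_on (\<lambda>y. (poly p y, poly q y)) (r ` {..<l})"
      using emb rI by (auto intro: inj_on_subset)
    ultimately show ?thesis
      using comp_inj_on[of r "{..<l}"] by (simp add: x_def[abs_def] o_def)
  qed
  have unique: "\<mu> = ?\<nu>" if \<mu>: "is_Berger_measure2 \<alpha> \<beta> \<mu>"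
  proof (rule atomic_measure_unique)
    show "finite_measure \<mu>"
      using \<mu> by (simp add: is_Berger_measure2_def prob_space_def)
    show "integrable \<mu> h \<and> (LINT y|\<mu>. h y) = (LINT y|?\<nu>. h y)"
      if "real_polynomial_function h" for h
      using same_polynomial_integrals_if_same_moments[of \<mu> ?\<nu> h] \<mu> \<nu>_int \<nu>_moment that
      by (simp add: is_Berger_measure2_def)
  qed (use \<mu> pos inj in \<open>auto simp: is_Berger_measure2_def intro: less_imp_le\<close>)
  show ?thesis
    using Berger unique unfolding x_def by blast
qed

end
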